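(* For every $p\in(0,\beta]$, with $\mathcal{P}=\mathcal{P}(\mu,s,\beta,\varphi)$, $$\inf_{\mathbb{P}\in\mathcal{P}}\mathrm{CR}(p,\mathbb{P})=\min\left\{\frac{\inf_{\mathbb{P}\in\mathcal{P}}\mathbb{P}(X\ge p)}{\sup_{\mathbb{P}\in\mathcal{P}}\mathbb{P}(X\ge p)},\ \frac{p}{\sup_{\mathbb{P}\in\mathcal{P}}\mathbb{E}_{\mathbb{P}}(X\mid X\ge p)}\right\}.$$
   Context: Let $0<\mu<\beta<\infty$, let $\varphi:[0,\beta]\to\mathbb{R}_{\ge 0}$ be strictly convex and differentiable, and let $s\in\mathbb{R}$. The ambiguity set $\mathcal{P}(\mu,s,\beta,\varphi)$ is the set of all probability distributions $\mathbb{P}$ of a real random variable $X$ with $\mathbb{P}(X\in[0,\beta])=1$, $\mathbb{E}_{\mathbb{P}}(X)=\mu$ and $\mathbb{E}_{\mathbb{P}}(\varphi(X))=s$. Standing assumptions: $s>\varphi(\mu)$, and $\tau_2<\beta$, where $\tau_2>0$ is the solution of $\frac{\varphi(\tau_2)-\varphi(0)}{\tau_2}=\frac{s-\varphi(0)}{\mu}$. For a price $p>0$: $\mathrm{REV}(p,\mathbb{P})=p\,\mathbb{P}(X\ge p)$, $\mathrm{OPT}(\mathbb{P})=\sup_{t>0}t\,\mathbb{P}(X\ge t)$, and $\mathrm{CR}(p,\mathbb{P})=\mathrm{REV}(p,\mathbb{P})/\mathrm{OPT}(\mathbb{P})$. The supremum of $\mathbb{E}_{\mathbb{P}}(X\mid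 X\ge p)$ is taken over those $\mathbb{P}\in\mathcal{P}$ with $\mathbb{P}(X\ge p)>0$. *)

theory Defs
  imports "HOL-Probability.Probability"
begin

definition strictly_convex_on :: "real set \<Rightarrow> (real \<Rightarrow> real) \<Rightarrow> bool" where
  "strictly_convex_on S f \<longleftrightarrow> convex S \<and>
     (\<forall>x\<in>S. \<forall>y\<in>S. \<forall>u. x \<noteq> y \<and> 0 < u \<and> u < 1 \<longrightarrow>
        f ((1 - u) * x + u * y) < (1 - u) * f x + u * f y)"

(* A distribution P of a real random variable X is represented by its law M on the Borel sets.
   The dispersion function phi is only given on [0,beta]. Since M is concentrated there, E(phi(X))
   is taken as an integral over [0,beta], so that the values of the HOL function phi outside
   [0,beta] (where it need not even be measurable) are irrelevant. *)
definition ambiguity_set ::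
    "real \<Rightarrow> real \<Rightarrow> real \<Rightarrow> (real \<Rightarrow> real) \<Rightarrow> real measure set" where
  "ambiguity_set \<mu> s \<beta> \<phi> =
     {M. real_distribution M \<and> measure M {0..\<beta>} = 1 \<and>
         (LINT x|M. x) = \<mu> \<and> (LINT x:{0..\<beta>}|M. \<phi> x) = s}"

definition REV :: "real \<Rightarrow> real measure \<Rightarrow> real" where
  "REV p M = p * measure M {p..}"

definition OPT :: "real measure \<Rightarrow> real" where
  "OPT M = (SUP t\<in>{0<..}. t * measure M {t..})"

definition CR :: "real \<Rightarrow> real measure \<Rightarrow> real" where
  "CR p M = REV p M / OPT M"

(* E(X | X >= p), meaningful when P(X >= p) > 0. *)
definition cond_mean_ge :: "real \<Rightarrow> real measure \<Rightarrow> real" where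
  "cond_mean_ge p M = (LINT x:{p..}|M. x) / measure M {p..}"

end

theory Submission
  imports Defs
begin

text \<open>
  Write \<open>A\<close>, \<open>B\<close> and \<open>R\<close> for the infimum and the supremum of \<open>P(X \<ge> p)\<close> and the supremum of
  \<open>E(X | X \<ge> p)\<close> over the ambiguity set. If \<open>p > \<tau>\<^sub>2\<close>, the law on \<open>{0, \<tau>\<^sub>2}\<close> with mean \<open>\<mu>\<close> belongs to
  the ambiguity set and gives \<open>X \<ge> p\<close> probability 0, so both sides of the formula are 0. Let
  \<open>p \<le> \<tau>\<^sub>2\<close>.

  For the lower bound, fix a law and a competing price \<open>t\<close>. If \<open>t > p\<close>, then
  \<open>t P(X \<ge> t) \<le> E(X; X \<ge> p) \<le> R P(X \<ge> p)\<close>. If \<open>t \<le> p\<close>, then \<open>t P(X \<ge> t) \<le> p B\<close>; this is where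
  \<open>p \<le> \<tau>\<^sub>2\<close> enters, since for \<open>p > \<tau>\<^sub>2\<close> the number \<open>p B\<close> is less than \<open>\<mu>\<close>, the revenue of the price
  \<open>\<tau>\<^sub>2\<close> under the law on \<open>{0, \<tau>\<^sub>2}\<close>.
  Hence \<open>OPT \<le> max (p B) (R P(X \<ge> p))\<close>, which is the claimed bound on the ratio.

  For the upper bound, one family of laws is extremal for \<open>A\<close>, \<open>B\<close> and \<open>R\<close> simultaneously. It has
  an atom at \<open>t < p\<close> and a single atom \<open>r\<close> that carries, up to a vanishing mass, everything above
  \<open>p\<close>. As \<open>t\<close> increases to \<open>p\<close>, \<open>P(X \<ge> p)\<close> tends to \<open>A\<close>, \<open>P(X \<ge> t)\<close> tends to \<open>B\<close>, and \<open>R\<close> is at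
  most \<open>r\<close>. The prices \<open>t\<close> and \<open>r\<close> then force the ratio down to \<open>A / B\<close> and \<open>p / R\<close>. The reduction
  to such a family is \<open>Inf_CR_eq_of_extremal_family\<close>.

  The family depends on the position of \<open>(\<mu>, s)\<close> relative to the line through \<open>(p, \<phi>(p))\<close> and
  \<open>(\<beta>, \<phi>(\<beta>))\<close>. Above it, the atoms are \<open>0\<close>, \<open>t\<close> and \<open>r = \<beta>\<close> (\<open>Inf_CR_atoms_0_p_top\<close>). On or below
  it, all mass can be placed at or above \<open>p\<close>, and the atoms are \<open>t\<close> and \<open>r\<close> with a vanishing atom
  at \<open>\<mu>\<close> (\<open>Inf_CR_atoms_p_r\<close>). Optimality is weak linear programming duality: functions
  \<open>c0 + c1 x + c2 \<phi>(x)\<close> have the same expectation under all laws in question, and convexity of \<open>\<phi>\<close>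
  makes suitable ones lie on one side of the indicator of \<open>X \<ge> p\<close>.
\<close>

section \<open>Convex chords and tangents\<close>

lemma strictly_convex_chord_less:
  assumes "strictly_convex_on S f" "x \<in> S" "z \<in> S" "x < y" "y < z"
  shows "(z - x) * f y < (z - y) * f x + (y - x) * f z"
proof -
  define u where "u = (y - x) / (z - x)"
  have u: "0 < u" "u < 1" and ux: "u * (z - x) = y - x"
    using assms by (auto simp: u_def field_simps)
  have y: "(1 - u) * x + u * z = y"
    using ux by (simp add: algebra_simps)
  have "f ((1 - u) * x + u * z) < (1 - u) * f x + u * f z"
    using assms u unfolding strictly_convex_on_def by auto
  then have "(z - x) * f y < (z - x) * ((1 - u) * f x + u * f z)"
    using assms y by simp
  also have "\<dots> = (z - x - u * (z - x)) * f x + u * (z - x) * f z"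
    by (simp add: algebra_simps)
  also have "\<dots> = (z - y) * f x + (y - x) * f z"
    unfolding ux by simp
  finally show ?thesis .
qed

lemma strictly_convex_chord_le:
  assumes "strictly_convex_on S f" "x \<in> S" "z \<in> S" "x \<le> y" "y \<le> z"
  shows "(z - x) * f y \<le> (z - y) * f x + (y - x) * f z"
proof (cases "x < y \<and> y < z")
  case True
  then show ?thesis using strictly_convex_chord_less[OF assms(1-3)] by (simp add: less_imp_le)
next
  case False
  then have "y = x \<or> y = z" using assms by auto
  then show ?thesis by (auto simp: algebra_simps)
qed

text \<open>On the segment from \<open>c\<close> to \<open>x\<close> convexity gives \<open>f (c + u (x - c)) - f c \<le> u (f x - f c)\<close>; divide by
  \<open>u\<close> and let \<open>u\<close> tend to 0. Only points of \<open>S\<close> are used, so \<open>c\<close> may be an end point of \<open>S\<close>.\<close>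
lemma strictly_convex_above_tangent:
  assumes conv: "strictly_convex_on S f" and "c \<in> S" "x \<in> S"
    and der: "(f has_real_derivative d) (at c within S)"
  shows "f c + d * (x - c) \<le> f x"
proof (cases "x = c")
  case False
  have "((\<lambda>y. (f y - f c) / (y - c)) \<longlongrightarrow> d) (at c within S)"
    using der by (simp add: has_field_derivative_iff)
  moreover have "filterlim (\<lambda>u. c + u * (x - c)) (at c within S) (at_right 0)"
  proof -
    have "((\<lambda>u. c + u * (x - c)) \<longlongrightarrow> c + 0 * (x - c)) (at_right 0)"
      by (intro tendsto_intros)
    moreover have "\<forall>\<^sub>F u in at_right 0. c + u * (x - c) \<in> S \<and> c + u * (x - c) \<noteq> c"
    proof -
      have "\<forall>\<^sub>F u in at_right 0. u \<in> {0<..<1::real}"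
        by (intro eventually_at_right_real) simp
      then show ?thesis
      proof eventually_elim
        case (elim u)
        have "convex S" using conv by (simp add: strictly_convex_on_def)
        then have "(1 - u) *\<^sub>R c + u *\<^sub>R x \<in> S"
          using assms elim by (intro convexD_alt) auto
        moreover have "(1 - u) *\<^sub>R c + u *\<^sub>R x = c + u * (x - c)"
          by (simp add: algebra_simps)
        ultimately show ?case using elim False by auto
      qed
    qed
    ultimately show ?thesis by (simp add: filterlim_at)
  qed
  ultimately have "((\<lambda>u. (f (c + u * (x - c)) - f c) / (c + u * (x - c) - c)) \<longlongrightarrow> d) (at_right 0)"
    by (rule filterlim_compose)
  then have "((\<lambda>u. (f (c + u * (x - c)) - f c) / (c + u * (x - c) - c) * (x - c)) \<longlongrightarrow> d * (x - c))
      (at_right 0)"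
    by (intro tendsto_intros)
  moreover have "\<forall>\<^sub>F u in at_right 0.
      (f (c + u * (x - c)) - f c) / (c + u * (x - c) - c) * (x - c) \<le> f x - f c"
  proof -
    have "\<forall>\<^sub>F u in at_right 0. u \<in> {0<..<1::real}"
      by (intro eventually_at_right_real) simp
    then show ?thesis
    proof eventually_elim
      case (elim u)
      have "f ((1 - u) * c + u * x) < (1 - u) * f c + u * f x"
        using conv assms elim False unfolding strictly_convex_on_def by auto
      moreover have "(1 - u) * c + u * x = c + u * (x - c)"
        by (simp add: algebra_simps)
      ultimately have "f (c + u * (x - c)) - f c \<le> u * (f x - f c)"
        by (simp add: algebra_simps)
      moreover have "(f (c + u * (x - c)) - f c) / (c + u * (x - c) - c) * (x - c)
          = (f (c + u * (x - c)) - f c) / u"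
        using elim False by simp
      ultimately show ?case
        using elim by (simp only: pos_divide_le_eq greaterThanLessThan_iff mult.commute)
    qed
  qed
  ultimately have "d * (x - c) \<le> f x - f c"
    by (intro tendsto_upperbound) auto
  then show ?thesis by simp
qed simp

lemma strictly_convex_above_tangent_strict:
  assumes conv: "strictly_convex_on S f" and "c \<in> S" "x \<in> S" "x \<noteq> c"
    and der: "(f has_real_derivative d) (at c within S)"
  shows "f c + d * (x - c) < f x"
proof -
  define m where "m = (1 - 1/2) * c + 1/2 * x"
  have "convex S" using conv by (simp add: strictly_convex_on_def)
  then have "(1 - 1/2) *\<^sub>R c + (1/2) *\<^sub>R x \<in> S"
    using assms by (intro convexD_alt) auto
  then have "m \<in> S" by (simp add: m_def)
  then have "f c + d * (m - c) \<le> f m"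
    using assms by (intro strictly_convex_above_tangent) auto
  moreover have "f m < (1 - 1/2) * f c + 1/2 * f x"
    unfolding m_def
    by (rule conv[unfolded strictly_convex_on_def, THEN conjunct2, rule_format])
      (use assms in auto)
  moreover have "m - c = (x - c) / 2" by (simp add: m_def field_simps)
  ultimately show ?thesis by (simp add: field_simps)
qed


section \<open>Laws with at most three atoms\<close>

lemma three_atom_law_exists:
  fixes a b c x y z :: real
  assumes "0 \<le> a" "0 \<le> b" "0 \<le> c" "a + b + c = 1"
  shows "\<exists>M. real_distribution M \<and>
    (\<forall>f\<in>borel_measurable borel. (LINT v|M. f v :: real) = a * f x + b * f y + c * f z)"
proof -
  define w where "w i = [a, b, c] ! i" for i
  define q where "q i = [x, y, z] ! i" for i
  define I where "I = {0, 1, 2::nat}"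
  define N where "N = point_measure I (\<lambda>i. ennreal (w i))"
  have w: "0 \<le> w i" if "i \<in> I" for i
    using that assms by (auto simp: I_def w_def)
  have q: "q \<in> measurable N borel" by (simp add: N_def)
  have "emeasure N (space N) = (\<Sum>i\<in>I. ennreal (w i))"
    by (simp add: N_def space_point_measure emeasure_point_measure_finite I_def)
  also have "\<dots> = ennreal (\<Sum>i\<in>I. w i)"
    using w by (rule sum_ennreal)
  also have "(\<Sum>i\<in>I. w i) = 1"
    using assms by (simp add: I_def w_def numeral_2_eq_2)
  finally interpret N: prob_space N
    by (intro prob_spaceI) simp
  have "(LINT v|distr N borel q. f v) = a * f x + b * f y + c * f z"
    if f: "f \<in> borel_measurable borel" for f :: "real \<Rightarrow> real"
  proof -
    have "(LINT v|distr N borel q. f v) = (LINT i|N. f (q i))"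
      using q f by (rule integral_distr)
    also have "\<dots> = (\<Sum>i\<in>I. w i *\<^sub>R f (q i))"
      unfolding N_def using w by (intro lebesgue_integral_point_measure_finite) (auto simp: I_def)
    finally show ?thesis by (simp add: I_def w_def q_def numeral_2_eq_2)
  qed
  moreover have "real_distribution (distr N borel q)"
    using q by (rule N.real_distribution_distr)
  ultimately show ?thesis by blast
qed

section \<open>Moments and tails of laws in the ambiguity set\<close>

locale moment_problem =
  fixes \<mu> \<beta> s :: real and \<phi> :: "real \<Rightarrow> real"
  assumes mean_pos: "0 < \<mu>" and mean_less: "\<mu> < \<beta>"
    and phi_convex: "strictly_convex_on {0..\<beta>} \<phi>"
    and phi_diff: "\<phi> differentiable_on {0..\<beta>}"
    and phi_mean_less: "\<phi> \<mu> < s"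
begin

abbreviation laws :: "real measure set" where
  "laws \<equiv> ambiguity_set \<mu> s \<beta> \<phi>"

lemmas chord_less = strictly_convex_chord_less[OF phi_convex]
lemmas chord_le = strictly_convex_chord_le[OF phi_convex]

lemma phi_cont: "continuous_on {0..\<beta>} \<phi>"
  using phi_diff by (rule differentiable_imp_continuous_on)

lemma phi_indicator_measurable [measurable]:
  "(\<lambda>x. indicator {0..\<beta>} x * \<phi> x) \<in> borel_measurable borel"
  using borel_measurable_continuous_on_indicator[of "{0..\<beta>}" \<phi>] phi_cont by simp

lemma lawsD:
  assumes "M \<in> laws"
  shows "real_distribution M" "AE x in M. x \<in> {0..\<beta>}" "(LINT x|M. x) = \<mu>"
    "(LINT x|M. indicator {0..\<beta>} x * \<phi> x) = s"
proof -
  show M: "real_distribution M" using assms by (simp add: ambiguity_set_def)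
  interpret real_distribution M by fact
  have "prob {0..\<beta>} = 1" using assms by (simp add: ambiguity_set_def)
  then show "AE x in M. x \<in> {0..\<beta>}" by (subst AE_in_set_eq_1) auto
  show "(LINT x|M. x) = \<mu>" "(LINT x|M. indicator {0..\<beta>} x * \<phi> x) = s"
    using assms by (simp_all add: ambiguity_set_def set_lebesgue_integral_def)
qed

lemma law_integrable_bounded:
  fixes f :: "real \<Rightarrow> real"
  assumes "M \<in> laws" "f \<in> borel_measurable borel"
    and "\<And>x. x \<in> {0..\<beta>} \<Longrightarrow> \<bar>f x\<bar> \<le> B"
  shows "integrable M f"
proof -
  interpret real_distribution M using assms by (simp add: lawsD)
  show ?thesis
  proof (rule integrable_const_bound)
    show "AE x in M. norm (f x) \<le> B"
      using lawsD(2)[OF assms(1)] by eventually_elim (simp add: assms(3))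
    show "f \<in> borel_measurable M" using assms(2) by simp
  qed
qed

lemma law_integrable_partial_mean:
  assumes "M \<in> laws"
  shows "integrable M (\<lambda>x. indicator {q..} x * x)"
  by (rule law_integrable_bounded[OF assms, of _ \<beta>]) (auto simp: indicator_def)

lemma law_integrable_tail:
  assumes "M \<in> laws"
  shows "integrable M (indicator {q..} :: real \<Rightarrow> real)"
  by (rule law_integrable_bounded[OF assms, of _ 1]) (auto simp: indicator_def)

text \<open>Weak duality: a function of the form \<open>c0 + c1 x + c2 \<phi>(x)\<close> has the same expectation under
  every law of the ambiguity set, so such a minorant of \<open>f\<close> bounds the expectation of \<open>f\<close>.\<close>
lemma moment_minorant:
  fixes f :: "real \<Rightarrow> real"
  assumes M: "M \<in> laws" and f: "f \<in> borel_measurable borel" "\<And>x. x \<in> {0..\<beta>} \<Longrightarrow> \<bar>f x\<bar> \<le> B"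
    and le: "\<And>x. x \<in> {0..\<beta>} \<Longrightarrow> c0 + c1 * x + c2 * \<phi> x \<le> f x"
  shows "c0 + c1 * \<mu> + c2 * s \<le> (LINT x|M. f x)"
proof -
  interpret real_distribution M using M by (simp add: lawsD)
  have "bounded (\<phi> ` {0..\<beta>})"
    by (intro compact_imp_bounded compact_continuous_image phi_cont) simp
  then obtain C where "\<forall>y\<in>\<phi> ` {0..\<beta>}. norm y \<le> C"
    unfolding bounded_iff by blast
  then have C: "\<bar>\<phi> x\<bar> \<le> C" if "x \<in> {0..\<beta>}" for x
    using that by auto
  have ix: "integrable M (\<lambda>x. x)"
    by (rule law_integrable_bounded[OF M, of _ \<beta>]) auto
  have ip: "integrable M (\<lambda>x. indicator {0..\<beta>} x * \<phi> x)"
    by (rule law_integrable_bounded[OF M, of _ C]) (use C in auto)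
  have if': "integrable M f"
    using M f by (rule law_integrable_bounded)
  have "c0 + c1 * \<mu> + c2 * s = (LINT x|M. c0 + c1 * x + c2 * (indicator {0..\<beta>} x * \<phi> x))"
    using ix ip prob_space by (simp add: lawsD[OF M])
  also have "\<dots> \<le> (LINT x|M. f x)"
  proof (rule integral_mono_AE)
    show "AE x in M. c0 + c1 * x + c2 * (indicator {0..\<beta>} x * \<phi> x) \<le> f x"
      using lawsD(2)[OF M] by eventually_elim (use le in auto)
  qed (use ix ip if' in auto)
  finally show ?thesis .
qed

lemma moment_majorant:
  fixes f :: "real \<Rightarrow> real"
  assumes M: "M \<in> laws" and f: "f \<in> borel_measurable borel" "\<And>x. x \<in> {0..\<beta>} \<Longrightarrow> \<bar>f x\<bar> \<le> B"
    and le: "\<And>x. x \<in> {0..\<beta>} \<Longrightarrow> f x \<le> c0 + c1 * x + c2 * \<phi> x"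
  shows "(LINT x|M. f x) \<le> c0 + c1 * \<mu> + c2 * s"
proof -
  have "- c0 + - c1 * \<mu> + - c2 * s \<le> (LINT x|M. - f x)"
    by (rule moment_minorant[OF M, of _ B]) (use f le in force)+
  then show ?thesis by simp
qed

lemma law_space: "M \<in> laws \<Longrightarrow> space M = UNIV"
  using lawsD(1) by (intro real_distribution.space_eq_univ)

lemma law_tail:
  assumes "M \<in> laws"
  shows "(LINT x|M. indicator {q..} x) = measure M {q..}"
proof -
  interpret real_distribution M using assms by (simp add: lawsD)
  show ?thesis by simp
qed

lemma tail_ge_minorant:
  assumes M: "M \<in> laws"
    and le: "\<And>x. x \<in> {0..\<beta>} \<Longrightarrow> c0 + c1 * x + c2 * \<phi> x \<le> indicator {q..} x"
  shows "c0 + c1 * \<mu> + c2 * s \<le> measure M {q..}"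
  unfolding law_tail[OF M, symmetric]
  by (rule moment_minorant[OF M, of _ 1]) (use le in \<open>auto simp: indicator_def\<close>)

lemma scaled_tail_le_majorant:
  assumes M: "M \<in> laws" and "0 \<le> k"
    and le: "\<And>x. x \<in> {0..\<beta>} \<Longrightarrow> k * indicator {q..} x \<le> c0 + c1 * x + c2 * \<phi> x"
  shows "k * measure M {q..} \<le> c0 + c1 * \<mu> + c2 * s"
proof -
  have "(LINT x|M. k * indicator {q..} x) \<le> c0 + c1 * \<mu> + c2 * s"
    by (rule moment_majorant[OF M, of _ k]) (use assms in \<open>auto simp: indicator_def\<close>)
  then show ?thesis by (simp add: law_space[OF M])
qed

definition partial_mean :: "real \<Rightarrow> real measure \<Rightarrow> real" where
  "partial_mean q M = (LINT x:{q..}|M. x)"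

lemma partial_mean_minus_tail_le:
  assumes M: "M \<in> laws"
    and le: "\<And>x. x \<in> {0..\<beta>} \<Longrightarrow> (x - r) * indicator {q..} x \<le> c0 + c1 * x + c2 * \<phi> x"
  shows "partial_mean q M - r * measure M {q..} \<le> c0 + c1 * \<mu> + c2 * s"
proof -
  have i: "integrable M (\<lambda>x. indicator {q..} x * x)" "integrable M (indicator {q..} :: real \<Rightarrow> real)"
    by (auto intro: law_integrable_partial_mean[OF M] law_integrable_tail[OF M])
  have "(LINT x|M. (x - r) * indicator {q..} x) \<le> c0 + c1 * \<mu> + c2 * s"
    by (rule moment_majorant[OF M, of _ "\<beta> + \<bar>r\<bar>"]) (use le in \<open>auto simp: indicator_def\<close>)
  moreover have "(LINT x|M. (x - r) * indicator {q..} x)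
      = (LINT x|M. indicator {q..} x * x - r * indicator {q..} x)"
    by (intro Bochner_Integration.integral_cong) (auto simp: algebra_simps)
  moreover have "\<dots> = partial_mean q M - r * measure M {q..}"
    using i by (simp add: law_space[OF M] partial_mean_def set_lebesgue_integral_def)
  ultimately show ?thesis by simp
qed

lemma scaled_tail_le_partial_mean:
  assumes M: "M \<in> laws" and "q \<le> t" "0 < t"
  shows "t * measure M {t..} \<le> partial_mean q M"
proof -
  have "(LINT x|M. t * indicator {t..} x) \<le> (LINT x|M. indicator {q..} x * x)"
  proof (rule integral_mono_AE)
    show "AE x in M. t * indicator {t..} x \<le> indicator {q..} x * x"
      using lawsD(2)[OF M] by eventually_elim (use assms in \<open>auto simp: indicator_def\<close>)
  qed (use law_integrable_partial_mean[OF M] law_integrable_tail[OF M] in auto)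
  then show ?thesis
    by (simp add: law_space[OF M] partial_mean_def set_lebesgue_integral_def)
qed

lemma partial_mean_ge:
  assumes M: "M \<in> laws"
  shows "p * measure M {p..} \<le> partial_mean p M"
proof -
  have "(LINT x|M. p * indicator {p..} x) \<le> (LINT x|M. indicator {p..} x * x)"
    by (intro integral_mono_AE AE_I2 integrable_mult_right
        law_integrable_partial_mean[OF M] law_integrable_tail[OF M]) (auto simp: indicator_def)
  then show ?thesis
    by (simp add: law_space[OF M] partial_mean_def set_lebesgue_integral_def)
qed

lemma revenue_bdd:
  assumes "M \<in> laws"
  shows "bdd_above ((\<lambda>t. t * measure M {t..}) ` {0<..})"
  by (rule bdd_aboveI[of _ "partial_mean 0 M"]) (use scaled_tail_le_partial_mean[OF assms] in auto)

lemma revenue_le_OPT: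
  assumes "M \<in> laws" "0 < t"
  shows "t * measure M {t..} \<le> OPT M"
  unfolding OPT_def using revenue_bdd[OF assms(1)] assms(2) by (intro cSUP_upper) auto

lemma OPT_le:
  assumes "\<And>t. 0 < t \<Longrightarrow> t * measure M {t..} \<le> c"
  shows "OPT M \<le> c"
  unfolding OPT_def using assms by (intro cSUP_least) auto

lemma CR_nonneg:
  assumes "M \<in> laws" "0 < p"
  shows "0 \<le> CR p M"
proof -
  have "0 \<le> p * measure M {p..}" using assms by simp
  with revenue_le_OPT[OF assms] show ?thesis by (simp add: CR_def REV_def)
qed

lemma law_tail_le_1: "M \<in> laws \<Longrightarrow> measure M {q..} \<le> 1"
  using lawsD(1)[of M] by (simp add: real_distribution_def prob_space.prob_le_1)

lemma three_atom_law_in_laws: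
  assumes w: "0 \<le> a" "0 \<le> b" "0 \<le> c" "a + b + c = 1"
    and xyz: "x \<in> {0..\<beta>}" "y \<in> {0..\<beta>}" "z \<in> {0..\<beta>}"
    and "a * x + b * y + c * z = \<mu>" "a * \<phi> x + b * \<phi> y + c * \<phi> z = s"
  shows "\<exists>M\<in>laws. \<forall>q. measure M {q..} = a * of_bool (q \<le> x) + b * of_bool (q \<le> y) + c * of_bool (q \<le> z)"
proof -
  obtain M where M: "real_distribution M"
    and E: "\<And>f. f \<in> borel_measurable borel \<Longrightarrow> (LINT v|M. f v :: real) = a * f x + b * f y + c * f z"
    using three_atom_law_exists[OF w, of x y z] by blast
  interpret real_distribution M by fact
  have mA: "measure M A = a * indicator A x + b * indicator A y + c * indicator A z"
    if "A \<in> sets borel" for A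
    using E[of "indicator A"] that by simp
  have "M \<in> laws"
    unfolding ambiguity_set_def mem_Collect_eq set_lebesgue_integral_def
    using assms M E[of "\<lambda>x. x"] E[OF phi_indicator_measurable] by (simp add: mA)
  moreover have "\<forall>q. measure M {q..} = a * of_bool (q \<le> x) + b * of_bool (q \<le> y) + c * of_bool (q \<le> z)"
    by (simp add: mA indicator_def)
  ultimately show ?thesis by blast
qed

end

section \<open>Reduction to an extremal family\<close>

context moment_problem
begin

lemma phi_tendsto_left:
  assumes "0 < p" "p < \<beta>"
  shows "(\<phi> \<longlongrightarrow> \<phi> p) (at_left p)"
proof -
  have "isCont \<phi> p"
    using assms by (intro continuous_on_interior[OF phi_cont]) auto
  then show ?thesis by (simp add: isCont_def filterlim_at_split)
qed

lemma Inf_CR_le: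
  assumes "M \<in> laws" "0 < p"
  shows "(INF M\<in>laws. CR p M) \<le> CR p M"
  using assms CR_nonneg by (intro cINF_lower bdd_belowI[of _ 0]) auto

text \<open>An atom at \<open>t < p\<close> does not count for \<open>X \<ge> p\<close>, however close \<open>t\<close> is to \<open>p\<close>, so the infimum of
  \<open>P(X \<ge> p)\<close> need not be attained and laws with \<open>t\<close> increasing to \<open>p\<close> are used. The competing prices
  \<open>t\<close> and \<open>r\<close>, the positions of the main atoms, bound the optimal revenue of these laws from below.\<close>
lemma Inf_CR_le_limit:
  assumes "0 < p" "0 < V" "0 < r"
    and fam: "\<forall>\<^sub>F t in at_left p. \<exists>M\<in>laws.
      measure M {p..} = u t \<and> v t \<le> measure M {t..} \<and> k t \<le> measure M {r..}"
    and u: "(u \<longlongrightarrow> w) (at_left p)" and v: "(v \<longlongrightarrow> V) (at_left p)" and k: "(k \<longlongrightarrow> w) (at_left p)"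
  shows "(INF M\<in>laws. CR p M) \<le> p * w / max (p * V) (r * w)"
proof (rule tendsto_lowerbound)
  have pos: "max (p * V) (r * w) \<noteq> 0"
    using mult_pos_pos[OF assms(1,2)] by linarith
  show "((\<lambda>t. p * u t / max (t * v t) (r * k t)) \<longlongrightarrow> p * w / max (p * V) (r * w)) (at_left p)"
    using u v k pos by (intro tendsto_intros) auto
  have "\<forall>\<^sub>F t in at_left p. 0 < v t"
    using v \<open>0 < V\<close> by (rule order_tendstoD)
  moreover have "\<forall>\<^sub>F t in at_left p. t \<in> {0<..<p}"
    using \<open>0 < p\<close> by (rule eventually_at_left_real)
  ultimately show "\<forall>\<^sub>F t in at_left p.
      (INF M\<in>laws. CR p M) \<le> p * u t / max (t * v t) (r * k t)"
    using fam
  proof eventually_elim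
    case (elim t)
    then obtain M where M: "M \<in> laws" "measure M {p..} = u t" "v t \<le> measure M {t..}"
      "k t \<le> measure M {r..}" by blast
    have "t * v t \<le> t * measure M {t..}" "r * k t \<le> r * measure M {r..}"
      using elim M \<open>0 < r\<close> by auto
    moreover have "t * measure M {t..} \<le> OPT M" "r * measure M {r..} \<le> OPT M"
      using revenue_le_OPT[OF M(1)] elim \<open>0 < r\<close> by auto
    ultimately have "max (t * v t) (r * k t) \<le> OPT M" by simp
    moreover have "0 < max (t * v t) (r * k t)"
      using elim by (simp add: less_max_iff_disj)
    moreover have "0 \<le> p * u t" using M(2)[symmetric] \<open>0 < p\<close> by simp
    ultimately have "CR p M \<le> p * u t / max (t * v t) (r * k t)"
      unfolding CR_def REV_def M(2) by (intro divide_left_mono) auto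
    with Inf_CR_le[OF M(1) \<open>0 < p\<close>] show ?case by linarith
  qed
qed simp

lemma cond_mean_bounds:
  assumes "M \<in> laws" "0 < measure M {p..}"
    and "partial_mean p M \<le> r * measure M {p..}"
  shows "p \<le> cond_mean_ge p M" "cond_mean_ge p M \<le> r"
proof -
  have eq: "cond_mean_ge p M = partial_mean p M / measure M {p..}"
    by (simp add: cond_mean_ge_def partial_mean_def)
  show "p \<le> cond_mean_ge p M" "cond_mean_ge p M \<le> r"
    unfolding eq using assms(2,3) partial_mean_ge[OF assms(1), of p]
    by (simp_all add: pos_le_divide_eq pos_divide_le_eq)
qed

text \<open>The lower bound splits the optimal price at \<open>p\<close>: a price \<open>t \<le> p\<close> earns at most
  \<open>p V\<close>, and a price \<open>t > p\<close> earns at most the part of the mean that lies above \<open>p\<close>. The upper bound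
  takes one family of laws that is extremal for the three optimization problems at once; \<open>w\<close>
  and \<open>V\<close> play the parts of the infimum and the supremum of \<open>P(X \<ge> p)\<close>, and \<open>r\<close> that of the supremum
  of \<open>E(X | X \<ge> p)\<close>.\<close>
lemma Inf_CR_eq_of_extremal_family:
  assumes p: "0 < p" and V: "0 < V" and r: "0 < r" and w: "0 \<le> w"
    and tail_ge: "\<And>M. M \<in> laws \<Longrightarrow> w \<le> measure M {p..}"
    and revenue_le: "\<And>M t. M \<in> laws \<Longrightarrow> 0 < t \<Longrightarrow> t \<le> p \<Longrightarrow> t * measure M {t..} \<le> p * V"
    and attained: "\<exists>M\<in>laws. V \<le> measure M {p..}"
    and mean_le: "\<And>M. M \<in> laws \<Longrightarrow> partial_mean p M \<le> r * measure M {p..}"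
    and fam: "\<forall>\<^sub>F t in at_left p. \<exists>M\<in>laws.
      measure M {p..} = u t \<and> v t \<le> measure M {t..} \<and> k t \<le> measure M {r..}"
    and lim: "(u \<longlongrightarrow> w) (at_left p)" "(v \<longlongrightarrow> V) (at_left p)" "(k \<longlongrightarrow> w) (at_left p)"
  shows "(INF M\<in>laws. CR p M) =
    min ((INF M\<in>laws. measure M {p..}) / (SUP M\<in>laws. measure M {p..}))
        (p / (SUP M\<in>{M \<in> laws. measure M {p..} > 0}. cond_mean_ge p M))"
proof -
  define A where "A = (INF M\<in>laws. measure M {p..})"
  define B where "B = (SUP M\<in>laws. measure M {p..})"
  define R where "R = (SUP M\<in>{M \<in> laws. measure M {p..} > 0}. cond_mean_ge p M)"
  obtain M0 where M0: "M0 \<in> laws" "V \<le> measure M0 {p..}" using attained by blast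
  have ne: "laws \<noteq> {}" using M0 by blast
  have A_le: "A \<le> measure M {p..}" if "M \<in> laws" for M
    unfolding A_def using that by (intro cINF_lower bdd_belowI[of _ 0]) auto
  have le_B: "measure M {p..} \<le> B" if "M \<in> laws" for M
    unfolding B_def using that law_tail_le_1 by (intro cSUP_upper bdd_aboveI[of _ 1]) auto
  have "w \<le> A" unfolding A_def using ne tail_ge by (intro cINF_greatest) auto
  have "V \<le> B" using M0 le_B by force
  have "B \<le> V" unfolding B_def
  proof (rule cSUP_least[OF ne])
    fix M assume "M \<in> laws"
    from revenue_le[OF this p order_refl] show "measure M {p..} \<le> V" using p by simp
  qed
  have le_R: "cond_mean_ge p M \<le> R" if "M \<in> laws" "0 < measure M {p..}" for M
    unfolding R_def using that cond_mean_bounds(2)[OF _ _ mean_le]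
    by (intro cSUP_upper bdd_aboveI[of _ r]) auto
  have "R \<le> r" unfolding R_def
    using M0 V cond_mean_bounds(2)[OF _ _ mean_le] by (intro cSUP_least) auto
  have M0_pos: "0 < measure M0 {p..}" using M0 V by linarith
  have "0 < R"
    using cond_mean_bounds(1)[OF M0(1) M0_pos mean_le[OF M0(1)]] le_R[OF M0(1) M0_pos] p by linarith
  have "(INF M\<in>laws. CR p M) \<le> min (A / B) (p / R)"
  proof -
    have pos: "0 < p * V" using p V by simp
    have "(INF M\<in>laws. CR p M) \<le> p * w / max (p * V) (r * w)"
      using p V r fam lim by (rule Inf_CR_le_limit)
    also have "\<dots> \<le> min (A / B) (p / R)"
    proof (rule min.boundedI)
      have "p * w / max (p * V) (r * w) \<le> p * w / (p * V)"
        using p w V pos by (intro divide_left_mono) (auto intro: mult_pos_pos simp: less_max_iff_disj)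
      also have "\<dots> = w / V" using p by simp
      also have "\<dots> \<le> A / B"
        using \<open>w \<le> A\<close> \<open>B \<le> V\<close> \<open>V \<le> B\<close> V by (intro frac_le) (use w in auto)
      finally show "p * w / max (p * V) (r * w) \<le> A / B" .
      show "p * w / max (p * V) (r * w) \<le> p / R"
      proof (cases "w = 0")
        case True
        then show ?thesis using p \<open>0 < R\<close> by simp
      next
        case False
        then have "0 < r * w" using w r by simp
        then have "p * w / max (p * V) (r * w) \<le> p * w / (r * w)"
          using p w by (intro divide_left_mono) (auto intro: mult_pos_pos simp: less_max_iff_disj)
        also have "\<dots> = p / r" using False by simp
        also have "\<dots> \<le> p / R" using \<open>R \<le> r\<close> \<open>0 < R\<close> p by (intro frac_le) auto
        finally show ?thesis .
      qed
    qed
    finally show ?thesis .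
  qed
  moreover have "min (A / B) (p / R) \<le> (INF M\<in>laws. CR p M)"
  proof (rule cINF_greatest[OF ne])
    fix M assume M: "M \<in> laws"
    define P where "P = measure M {p..}"
    show "min (A / B) (p / R) \<le> CR p M"
    proof (cases "0 < P")
      case False
      then have "A \<le> 0" using A_le[OF M] by (simp add: P_def)
      then have "A / B \<le> 0" using V \<open>V \<le> B\<close> by (intro divide_nonpos_pos) auto
      then show ?thesis using CR_nonneg[OF M p] by linarith
    next
      case True
      have pm: "partial_mean p M \<le> R * P"
        using le_R[OF M] True
        by (simp add: P_def cond_mean_ge_def partial_mean_def pos_divide_le_eq)
      have OPT: "OPT M \<le> max (p * B) (R * P)"
      proof (rule OPT_le)
        fix t :: real assume t: "0 < t"
        show "t * measure M {t..} \<le> max (p * B) (R * P)"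
        proof (cases "t \<le> p")
          case True
          have "p * V \<le> p * B" using \<open>V \<le> B\<close> p by simp
          with revenue_le[OF M t True] show ?thesis by linarith
        next
          case False
          then show ?thesis using scaled_tail_le_partial_mean[OF M, of p t] t pm by linarith
        qed
      qed
      have OPT_pos: "0 < OPT M"
        using revenue_le_OPT[OF M p] mult_pos_pos[OF p True] by (simp add: P_def)
      show ?thesis
      proof (cases "OPT M \<le> p * B")
        case True
        have "A / B \<le> P / B" using A_le[OF M] V \<open>V \<le> B\<close> by (intro divide_right_mono) (auto simp: P_def)
        also have "\<dots> = p * P / (p * B)" using p by simp
        also have "\<dots> \<le> p * P / OPT M"
          using True OPT_pos p \<open>0 < P\<close> by (intro divide_left_mono) (auto intro: mult_pos_pos)
        finally show ?thesis by (simp add: CR_def REV_def P_def)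
      next
        case False
        have "p / R = p * P / (R * P)" using True by simp
        also have "\<dots> \<le> p * P / OPT M"
          using False OPT OPT_pos p \<open>0 < P\<close> by (intro divide_left_mono) (auto intro: mult_pos_pos)
        finally show ?thesis by (simp add: CR_def REV_def P_def)
      qed
    qed
  qed
  ultimately show ?thesis unfolding A_def B_def R_def by (rule antisym)
qed

end

section \<open>The extremal laws\<close>

locale feasible_moment_problem = moment_problem +
  fixes \<tau> :: real
  assumes tau_pos: "0 < \<tau>" and tau_less: "\<tau> < \<beta>"
    and tau_slope: "(\<phi> \<tau> - \<phi> 0) / \<tau> = (s - \<phi> 0) / \<mu>"
begin

lemma tau_eq: "\<mu> * (\<phi> \<tau> - \<phi> 0) = \<tau> * (s - \<phi> 0)"
  using tau_slope tau_pos mean_pos by (simp add: field_simps)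

lemma slope_from_0_less:
  assumes "0 < x" "x < y" "y \<le> \<beta>"
  shows "y * (\<phi> x - \<phi> 0) < x * (\<phi> y - \<phi> 0)"
  using chord_less[of 0 y x] assms by (auto simp: algebra_simps)

lemma mean_less_tau: "\<mu> < \<tau>"
proof (rule ccontr)
  assume "\<not> \<mu> < \<tau>"
  then have "\<mu> * (\<phi> \<tau> - \<phi> 0) \<le> \<tau> * (\<phi> \<mu> - \<phi> 0)"
    using slope_from_0_less[of \<tau> \<mu>] tau_pos mean_less by (cases "\<mu> = \<tau>") auto
  also have "\<dots> < \<tau> * (s - \<phi> 0)" using phi_mean_less tau_pos by simp
  finally show False using tau_eq by simp
qed

text \<open>The law on \<open>{0, \<beta>}\<close> with mean \<open>\<mu>\<close> has a larger mean of \<open>\<phi>\<close> than the law on \<open>{0, \<tau>}\<close>, for which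
  this mean is \<open>s\<close>.\<close>
lemma moment_below_wide_chord: "\<beta> * (s - \<phi> 0) < \<mu> * (\<phi> \<beta> - \<phi> 0)"
proof -
  have "\<mu> * (\<beta> * (\<phi> \<tau> - \<phi> 0)) < \<mu> * (\<tau> * (\<phi> \<beta> - \<phi> 0))"
    using slope_from_0_less[of \<tau> \<beta>] tau_pos tau_less mean_pos by simp
  then have "\<tau> * (\<beta> * (s - \<phi> 0)) < \<tau> * (\<mu> * (\<phi> \<beta> - \<phi> 0))"
    using tau_eq by (metis mult.left_commute)
  then show ?thesis using tau_pos by simp
qed

lemma moment_above_narrow_chord:
  assumes "0 < x" "x \<le> \<tau>"
  shows "\<mu> * (\<phi> x - \<phi> 0) \<le> x * (s - \<phi> 0)"
proof -
  have "\<tau> * (\<phi> x - \<phi> 0) \<le> x * (\<phi> \<tau> - \<phi> 0)"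
    using slope_from_0_less[of x \<tau>] assms tau_less by (cases "x = \<tau>") auto
  then have "\<mu> * (\<tau> * (\<phi> x - \<phi> 0)) \<le> \<mu> * (x * (\<phi> \<tau> - \<phi> 0))"
    using mean_pos by simp
  then have "\<tau> * (\<mu> * (\<phi> x - \<phi> 0)) \<le> \<tau> * (x * (s - \<phi> 0))"
    using tau_eq by (metis mult.left_commute)
  then show ?thesis using tau_pos by simp
qed

text \<open>As \<open>s\<close> lies strictly between the means of \<open>\<phi>\<close> under the point mass at \<open>\<mu>\<close> and under the law on
  \<open>{0, \<beta>}\<close> with mean \<open>\<mu>\<close>, a mixture of the two does it. This keeps the supremum of conditional means
  from ranging over the empty set.\<close>
lemma exists_law_with_top_atom: "\<exists>M\<in>laws. \<forall>q\<le>\<beta>. 0 < measure M {q..}"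
proof -
  define C where "C = \<phi> 0 + \<mu> / \<beta> * (\<phi> \<beta> - \<phi> 0)"
  define l where "l = (s - \<phi> \<mu>) / (C - \<phi> \<mu>)"
  have b: "0 < \<beta>" using mean_pos mean_less by simp
  have "s < C" using moment_below_wide_chord b by (simp add: C_def field_simps)
  then have l: "0 < l" "l \<le> 1" and lC: "l * (C - \<phi> \<mu>) = s - \<phi> \<mu>"
    using phi_mean_less by (auto simp: l_def)
  have m: "0 < \<mu> / \<beta>" "\<mu> / \<beta> \<le> 1" using mean_pos mean_less by auto
  have pos: "0 < l * (\<mu> / \<beta>)" using l(1) m(1) by (rule mult_pos_pos)
  have "\<exists>M\<in>laws. \<forall>q. measure M {q..} = l * (1 - \<mu> / \<beta>) * of_bool (q \<le> 0)
      + (1 - l) * of_bool (q \<le> \<mu>) + l * (\<mu> / \<beta>) * of_bool (q \<le> \<beta>)"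
  proof (rule three_atom_law_in_laws)
    show "l * (1 - \<mu> / \<beta>) * 0 + (1 - l) * \<mu> + l * (\<mu> / \<beta>) * \<beta> = \<mu>"
      using b by (simp add: algebra_simps)
    have "l * (1 - \<mu> / \<beta>) * \<phi> 0 + (1 - l) * \<phi> \<mu> + l * (\<mu> / \<beta>) * \<phi> \<beta> = \<phi> \<mu> + l * (C - \<phi> \<mu>)"
      by (simp add: C_def algebra_simps)
    then show "l * (1 - \<mu> / \<beta>) * \<phi> 0 + (1 - l) * \<phi> \<mu> + l * (\<mu> / \<beta>) * \<phi> \<beta> = s"
      using lC by simp
    show "0 \<le> l * (1 - \<mu> / \<beta>)" "0 \<le> l * (\<mu> / \<beta>)"
      using l m by (auto intro!: mult_nonneg_nonneg simp del: times_divide_eq_right)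
    show "l * (1 - \<mu> / \<beta>) + (1 - l) + l * (\<mu> / \<beta>) = 1"
      by (simp add: algebra_simps)
  qed (use l mean_pos mean_less in auto)
  then obtain M where M: "M \<in> laws" "\<And>q. measure M {q..} = l * (1 - \<mu> / \<beta>) * of_bool (q \<le> 0)
      + (1 - l) * of_bool (q \<le> \<mu>) + l * (\<mu> / \<beta>) * of_bool (q \<le> \<beta>)" by blast
  have "0 < measure M {q..}" if "q \<le> \<beta>" for q
  proof -
    have "0 \<le> l * (1 - \<mu> / \<beta>) * of_bool (q \<le> 0)" "0 \<le> (1 - l) * of_bool (q \<le> \<mu>)"
      using l m by auto
    then show ?thesis using that pos unfolding M(2) by simp
  qed
  then show ?thesis using M(1) by blast
qed

text \<open>The law on \<open>{0, \<tau>}\<close> never pays a price above \<open>\<tau>\<close>, so both sides vanish.\<close>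
lemma Inf_CR_high_price:
  assumes "\<tau> < p" "p \<le> \<beta>"
  shows "(INF M\<in>laws. CR p M) =
    min ((INF M\<in>laws. measure M {p..}) / (SUP M\<in>laws. measure M {p..}))
        (p / (SUP M\<in>{M \<in> laws. measure M {p..} > 0}. cond_mean_ge p M))"
proof -
  have p: "0 < p" using assms tau_pos by simp
  have "\<exists>M\<in>laws. \<forall>q. measure M {q..} = (1 - \<mu> / \<tau>) * of_bool (q \<le> 0)
      + \<mu> / \<tau> * of_bool (q \<le> \<tau>) + 0 * of_bool (q \<le> \<beta>)"
  proof (rule three_atom_law_in_laws)
    have "\<tau> * ((1 - \<mu> / \<tau>) * \<phi> 0 + \<mu> / \<tau> * \<phi> \<tau> + 0 * \<phi> \<beta>) = \<tau> * \<phi> 0 + \<mu> * (\<phi> \<tau> - \<phi> 0)"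
      using tau_pos by (simp add: field_simps)
    also have "\<dots> = \<tau> * s" using tau_eq by (simp add: algebra_simps)
    finally show "(1 - \<mu> / \<tau>) * \<phi> 0 + \<mu> / \<tau> * \<phi> \<tau> + 0 * \<phi> \<beta> = s"
      using tau_pos by simp
  qed (use mean_less_tau tau_pos tau_less mean_pos in auto)
  then obtain M0 where M0: "M0 \<in> laws" "measure M0 {p..} = 0"
    using assms p by auto
  have "(INF M\<in>laws. measure M {p..}) = 0"
  proof (rule antisym)
    have "(INF M\<in>laws. measure M {p..}) \<le> measure M0 {p..}"
      using M0 by (intro cINF_lower bdd_belowI[of _ 0]) auto
    then show "(INF M\<in>laws. measure M {p..}) \<le> 0" using M0 by simp
    show "0 \<le> (INF M\<in>laws. measure M {p..})"
      using M0 by (intro cINF_greatest) auto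
  qed
  moreover have "(INF M\<in>laws. CR p M) = 0"
  proof (rule antisym)
    show "(INF M\<in>laws. CR p M) \<le> 0"
      using Inf_CR_le[OF M0(1) p] M0(2) by (simp add: CR_def REV_def)
    show "0 \<le> (INF M\<in>laws. CR p M)"
      using M0 CR_nonneg[OF _ p] by (intro cINF_greatest) auto
  qed
  moreover have "0 \<le> (SUP M\<in>{M \<in> laws. measure M {p..} > 0}. cond_mean_ge p M)"
  proof -
    obtain M where M: "M \<in> laws" "0 < measure M {p..}"
      using exists_law_with_top_atom assms by blast
    have le: "partial_mean p N \<le> \<beta> * measure N {p..}" if "N \<in> laws" for N
      using partial_mean_minus_tail_le[OF that, of \<beta> p 0 0 0] by (auto simp: indicator_def)
    have "cond_mean_ge p M \<le> (SUP M\<in>{M \<in> laws. measure M {p..} > 0}. cond_mean_ge p M)"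
      using M cond_mean_bounds(2)[OF _ _ le] by (intro cSUP_upper bdd_aboveI[of _ \<beta>]) auto
    then show ?thesis using cond_mean_bounds(1)[OF M le[OF M(1)]] p by linarith
  qed
  ultimately show ?thesis using p by simp
qed

text \<open>If \<open>(\<mu>, s)\<close> lies above the line through the points of the graph of \<open>\<phi>\<close> at \<open>p\<close> and \<open>\<beta>\<close>, the
  law with atoms \<open>0\<close>, \<open>p\<close> and \<open>\<beta>\<close> has positive mass at \<open>0\<close>, and the extremal laws have atoms
  \<open>0\<close>, \<open>t\<close> and \<open>\<beta>\<close> with \<open>t\<close> increasing to \<open>p\<close>. The dual functions come from \<open>\<phi>\<close> minus its line
  through \<open>0\<close> and \<open>p\<close>, which is nonpositive on \<open>[0, p]\<close> and below a chord on \<open>[p, \<beta>]\<close>.\<close>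
lemma Inf_CR_atoms_0_p_top:
  assumes p: "0 < p" "p \<le> \<tau>"
    and above: "(\<beta> - \<mu>) * \<phi> p + (\<mu> - p) * \<phi> \<beta> < s * (\<beta> - p)"
  shows "(INF M\<in>laws. CR p M) =
    min ((INF M\<in>laws. measure M {p..}) / (SUP M\<in>laws. measure M {p..}))
        (p / (SUP M\<in>{M \<in> laws. measure M {p..} > 0}. cond_mean_ge p M))"
proof -
  define K where "K t = (\<phi> t - \<phi> 0) / t" for t
  define D where "D t = \<phi> \<beta> - \<phi> 0 - K t * \<beta>" for t
  \<comment> \<open>The weights \<open>1 - a t - b t\<close>, \<open>a t\<close> and \<open>b t\<close> at \<open>0\<close>, \<open>t\<close> and \<open>\<beta>\<close> solve the moment equations.\<close>
  define b where "b t = (s - \<phi> 0 - K t * \<mu>) / D t" for t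
  define a where "a t = (\<mu> - \<beta> * b t) / t" for t
  define e where "e x = \<phi> x - \<phi> 0 - K p * x" for x
  have pb: "p < \<beta>" and b0: "0 < \<beta>" using p tau_less by auto
  have Kt: "K t * t = \<phi> t - \<phi> 0" if "0 < t" for t using that by (simp add: K_def)
  have D: "0 < D t" if "0 < t" "t \<le> p" for t
    using slope_from_0_less[of t \<beta>] that pb by (simp add: D_def K_def field_simps)
  have bD: "b t * D t = s - \<phi> 0 - K t * \<mu>" if "0 < t" "t \<le> p" for t
    using D[OF that] by (simp add: b_def)
  have b_nonneg: "0 \<le> b t" if "0 < t" "t \<le> p" for t
  proof -
    have "K t * \<mu> \<le> s - \<phi> 0"
      using moment_above_narrow_chord[of t] that p by (simp add: K_def field_simps)
    then show ?thesis using D[OF that] by (simp add: b_def)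
  qed
  have mean: "a t * t + b t * \<beta> = \<mu>" if "0 < t" for t
    using that by (simp add: a_def)
  have phi_mean: "(1 - a t - b t) * \<phi> 0 + a t * \<phi> t + b t * \<phi> \<beta> = s" if t: "0 < t" "t \<le> p" for t
  proof -
    have "(1 - a t - b t) * \<phi> 0 + a t * \<phi> t + b t * \<phi> \<beta>
        = \<phi> 0 + a t * (K t * t) + b t * (D t + K t * \<beta>)"
      unfolding Kt[OF t(1)] by (simp add: D_def algebra_simps)
    also have "\<dots> = \<phi> 0 + K t * (a t * t + b t * \<beta>) + b t * D t"
      by (simp add: algebra_simps)
    finally show ?thesis unfolding mean[OF t(1)] bD[OF t] by simp
  qed
  have a_nonneg: "0 \<le> a t" if t: "0 < t" "t \<le> p" for t
  proof -
    have "\<beta> * (s - \<phi> 0 - K t * \<mu>) \<le> \<mu> * D t"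
      using moment_below_wide_chord by (simp add: D_def algebra_simps)
    then have "\<beta> * b t \<le> \<mu>"
      using D[OF t] by (simp add: b_def pos_divide_le_eq)
    then show ?thesis using t by (simp add: a_def)
  qed
  \<comment> \<open>Replacing \<open>\<phi> 0\<close> by the value at 0 of the line through \<open>p\<close> and \<open>\<beta>\<close> turns the mean \<open>s\<close> of \<open>\<phi>\<close> into
    the value of that line at \<open>\<mu>\<close>; since both changes are downward, the weight at 0 is positive.\<close>
  have bot_pos: "0 < 1 - a p - b p"
  proof -
    have "(1 - a p - b p) * ((\<beta> - p) * \<phi> 0 - \<beta> * \<phi> p + p * \<phi> \<beta>)
        = ((1 - a p - b p) * \<phi> 0 + a p * \<phi> p + b p * \<phi> \<beta>) * (\<beta> - p)
          - ((\<beta> - (a p * p + b p * \<beta>)) * \<phi> p + ((a p * p + b p * \<beta>) - p) * \<phi> \<beta>)"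
      by (simp add: algebra_simps)
    also have "\<dots> = s * (\<beta> - p) - ((\<beta> - \<mu>) * \<phi> p + (\<mu> - p) * \<phi> \<beta>)"
      by (simp only: mean[OF p(1)] phi_mean[OF p(1) order_refl])
    also have "\<dots> > 0" using above by simp
    finally have "0 < (1 - a p - b p) * ((\<beta> - p) * \<phi> 0 - \<beta> * \<phi> p + p * \<phi> \<beta>)" .
    moreover have "0 < (\<beta> - p) * \<phi> 0 - \<beta> * \<phi> p + p * \<phi> \<beta>"
      using chord_less[of 0 \<beta> p] p pb by auto
    ultimately show ?thesis by (simp add: zero_less_mult_iff)
  qed
  have law: "\<exists>M\<in>laws. \<forall>q. measure M {q..} = (1 - a t - b t) * of_bool (q \<le> 0)
      + a t * of_bool (q \<le> t) + b t * of_bool (q \<le> \<beta>)"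
    if t: "0 < t" "t \<le> p" and bot: "0 \<le> 1 - a t - b t" for t
    using t bot pb b0 mean[OF t(1)] phi_mean[OF t]
    by (intro three_atom_law_in_laws a_nonneg b_nonneg) auto
  have "(K \<longlongrightarrow> K p) (at_left p)"
    unfolding K_def by (intro tendsto_intros phi_tendsto_left) (use p pb in auto)
  then have b_lim: "(b \<longlongrightarrow> b p) (at_left p)"
    unfolding b_def D_def by (intro tendsto_intros) (use D[OF p(1) order_refl] in \<open>auto simp: D_def\<close>)
  then have a_lim: "(a \<longlongrightarrow> a p) (at_left p)"
    unfolding a_def by (intro tendsto_intros) (use p in auto)
  have e_left: "e x \<le> 0" if "0 \<le> x" "x \<le> p" for x
  proof -
    have "p * \<phi> x \<le> (p - x) * \<phi> 0 + x * \<phi> p"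
      using chord_le[of 0 p x] that p pb by auto
    moreover have "p * e x = p * \<phi> x - p * \<phi> 0 - x * (K p * p)"
      by (simp add: e_def algebra_simps)
    ultimately have "p * e x \<le> 0"
      unfolding Kt[OF p(1)] by (simp add: algebra_simps)
    then show ?thesis using p by (simp add: mult_le_0_iff)
  qed
  have e_right: "(\<beta> - p) * e x \<le> (x - p) * D p" if "p \<le> x" "x \<le> \<beta>" for x
  proof -
    have phi_p: "\<phi> p = \<phi> 0 + K p * p" and phi_b: "\<phi> \<beta> = \<phi> 0 + K p * \<beta> + D p"
      using Kt[OF p(1)] by (simp_all add: D_def)
    have "(\<beta> - p) * \<phi> x \<le> (\<beta> - x) * \<phi> p + (x - p) * \<phi> \<beta>"
      using chord_le[of p \<beta> x] that p pb by auto
    then show ?thesis unfolding phi_p phi_b by (simp add: e_def algebra_simps)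
  qed
  define c where "c = (\<beta> - p) / D p"
  have Dp: "0 < D p" using D p by simp
  have c: "0 < c" "c * D p = \<beta> - p" using Dp pb by (auto simp: c_def)
  show ?thesis
  proof (rule Inf_CR_eq_of_extremal_family[where w = "b p" and V = "a p + b p" and r = \<beta>
        and u = b and v = "\<lambda>t. a t + b t" and k = b])
    show "0 < p" "0 < \<beta>" by (fact p(1) b0)+
    show "0 \<le> b p" using b_nonneg p by simp
    show "0 < a p + b p"
    proof (rule ccontr)
      assume "\<not> 0 < a p + b p"
      then have "a p = 0" "b p = 0" using a_nonneg[of p] b_nonneg[of p] p by auto
      then show False using mean[OF p(1)] mean_pos by simp
    qed
    show "b p \<le> measure M {p..}" if M: "M \<in> laws" for M
    proof -
      have "- \<phi> 0 / D p + - K p / D p * \<mu> + 1 / D p * s \<le> measure M {p..}"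
      proof (rule tail_ge_minorant[OF M])
        fix x assume x: "x \<in> {0..\<beta>}"
        have "- \<phi> 0 / D p + - K p / D p * x + 1 / D p * \<phi> x = e x / D p"
          by (simp add: e_def diff_divide_distrib)
        also have "\<dots> \<le> indicator {p..} x"
        proof (cases "x < p")
          case True
          then show ?thesis using e_left[of x] x Dp by (simp add: divide_nonpos_pos)
        next
          case False
          then have "(\<beta> - p) * e x \<le> (x - p) * D p" using e_right x by auto
          also have "\<dots> \<le> (\<beta> - p) * D p" using x Dp by simp
          finally have "e x \<le> D p" using pb by simp
          then show ?thesis using False Dp by (simp add: pos_divide_le_eq)
        qed
        finally show "- \<phi> 0 / D p + - K p / D p * x + 1 / D p * \<phi> x \<le> indicator {p..} x" .
      qed
      moreover have "- \<phi> 0 / D p + - K p / D p * \<mu> + 1 / D p * s = b p"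
        by (simp add: b_def diff_divide_distrib)
      ultimately show ?thesis by simp
    qed
    \<comment> \<open>The majorant \<open>x - c e(x)\<close> of \<open>t 1(x \<ge> t)\<close> vanishes at 0 and equals \<open>p\<close> at \<open>p\<close> and \<open>\<beta>\<close>, so its
      expectation under the law on \<open>{0, p, \<beta>}\<close> is exactly \<open>p (a p + b p)\<close>.\<close>
    show "t * measure M {t..} \<le> p * (a p + b p)" if M: "M \<in> laws" and t: "0 < t" "t \<le> p" for M t
    proof -
      have "t * measure M {t..} \<le> c * \<phi> 0 + (1 + c * K p) * \<mu> + - c * s"
      proof (rule scaled_tail_le_majorant[OF M])
        fix x assume x: "x \<in> {0..\<beta>}"
        have "t * indicator {t..} x \<le> x - c * e x"
        proof (cases "x \<le> p")
          case True
          then have "c * e x \<le> 0" using e_left x c by (simp add: mult_nonneg_nonpos)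
          then show ?thesis using x by (auto simp: indicator_def)
        next
          case False
          have "c * e x = (\<beta> - p) * e x / D p" by (simp add: c_def)
          also have "\<dots> \<le> x - p" using e_right[of x] False x Dp by (simp add: pos_divide_le_eq)
          finally show ?thesis using t False by (auto simp: indicator_def)
        qed
        then show "t * indicator {t..} x \<le> c * \<phi> 0 + (1 + c * K p) * x + - c * \<phi> x"
          by (simp add: e_def algebra_simps)
      qed (use t in simp)
      also have "\<dots> = \<mu> - c * (s - \<phi> 0 - K p * \<mu>)"
        by (simp add: algebra_simps)
      also have "\<dots> = \<mu> - c * (b p * D p)"
        unfolding bD[OF p(1) order_refl] ..
      also have "\<dots> = \<mu> - b p * (\<beta> - p)" using c(2) by (simp add: mult.left_commute)
      also have "\<dots> = p * (a p + b p)" using mean[OF p(1)] by (simp add: algebra_simps)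
      finally show ?thesis .
    qed
    show "\<exists>M\<in>laws. a p + b p \<le> measure M {p..}"
    proof -
      obtain M where M: "M \<in> laws" "\<And>q. measure M {q..} = (1 - a p - b p) * of_bool (q \<le> 0)
          + a p * of_bool (q \<le> p) + b p * of_bool (q \<le> \<beta>)"
        using law[OF p(1) order_refl less_imp_le[OF bot_pos]] by blast
      show ?thesis by (rule bexI[OF _ M(1)]) (use M(2) p pb in simp)
    qed
    show "partial_mean p M \<le> \<beta> * measure M {p..}" if "M \<in> laws" for M
      using partial_mean_minus_tail_le[OF that, of \<beta> p 0 0 0] by (auto simp: indicator_def)
    have "((\<lambda>t. 1 - a t - b t) \<longlongrightarrow> 1 - a p - b p) (at_left p)"
      by (intro tendsto_intros a_lim b_lim)
    then have "\<forall>\<^sub>F t in at_left p. 0 < 1 - a t - b t"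
      using bot_pos by (rule order_tendstoD)
    moreover have "\<forall>\<^sub>F t in at_left p. t \<in> {0<..<p}"
      using p(1) by (rule eventually_at_left_real)
    ultimately show "\<forall>\<^sub>F t in at_left p. \<exists>M\<in>laws.
        measure M {p..} = b t \<and> a t + b t \<le> measure M {t..} \<and> b t \<le> measure M {\<beta>..}"
    proof eventually_elim
      case (elim t)
      then obtain M where M: "M \<in> laws" "\<And>q. measure M {q..} = (1 - a t - b t) * of_bool (q \<le> 0)
          + a t * of_bool (q \<le> t) + b t * of_bool (q \<le> \<beta>)"
        using law[of t] by force
      show ?case
        by (intro bexI[OF _ M(1)]) (use elim M(2) pb b0 in auto)
    qed
    show "(b \<longlongrightarrow> b p) (at_left p)" "(b \<longlongrightarrow> b p) (at_left p)" by (fact b_lim)+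
    show "((\<lambda>t. a t + b t) \<longlongrightarrow> a p + b p) (at_left p)" by (intro tendsto_intros a_lim b_lim)
  qed
qed

text \<open>If \<open>(\<mu>, s)\<close> lies on or below the line through the points of the graph of \<open>\<phi>\<close> at \<open>p\<close> and \<open>\<beta>\<close>,
  then \<open>p < \<mu>\<close>, some \<open>r\<close> makes the chord of \<open>\<phi>\<close> over \<open>[p, r]\<close> pass through
  \<open>(\<mu>, s)\<close>, and the law on \<open>{p, r}\<close> is extremal. Lowering its bottom atom to \<open>t < p\<close> while keeping
  the mean \<open>\<mu>\<close> raises the mean of \<open>\<phi>\<close>; mixing in a small atom at \<open>\<mu>\<close> corrects this. This keeps
  \<open>r\<close> fixed, so that the limit does not involve \<open>r\<close> as an implicit function of \<open>t\<close>. The dual functions come from \<open>\<phi>\<close> minus its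
  tangent at \<open>r\<close>.\<close>
lemma Inf_CR_atoms_p_r:
  assumes p: "0 < p" "p \<le> \<tau>"
    and below: "s * (\<beta> - p) \<le> (\<beta> - \<mu>) * \<phi> p + (\<mu> - p) * \<phi> \<beta>"
  shows "(INF M\<in>laws. CR p M) =
    min ((INF M\<in>laws. measure M {p..}) / (SUP M\<in>laws. measure M {p..}))
        (p / (SUP M\<in>{M \<in> laws. measure M {p..} > 0}. cond_mean_ge p M))"
proof -
  have pb: "p < \<beta>" using p tau_less by simp
  have pmu: "p < \<mu>"
  proof (rule ccontr)
    assume "\<not> p < \<mu>"
    then have "(\<beta> - \<mu>) * \<phi> p \<le> (\<beta> - p) * \<phi> \<mu> + (p - \<mu>) * \<phi> \<beta>"
      using chord_le[of \<mu> \<beta> p] pb mean_pos mean_less by auto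
    with below have "s * (\<beta> - p) \<le> \<phi> \<mu> * (\<beta> - p)" by (simp add: algebra_simps)
    then show False using phi_mean_less pb by simp
  qed
  define F where "F x = (x - \<mu>) * \<phi> p + (\<mu> - p) * \<phi> x - s * (x - p)" for x
  have "F \<mu> = (\<mu> - p) * (\<phi> \<mu> - s)" by (simp add: F_def algebra_simps)
  then have F_mu: "F \<mu> < 0" using pmu phi_mean_less by (simp add: mult_pos_neg)
  have "\<exists>x\<ge>\<mu>. x \<le> \<beta> \<and> F x = 0"
  proof (rule IVT')
    show "continuous_on {\<mu>..\<beta>} F" unfolding F_def
      by (intro continuous_intros continuous_on_subset[OF phi_cont]) (use mean_pos in auto)
  qed (use F_mu below mean_less in \<open>auto simp: F_def\<close>)
  then obtain r where r: "\<mu> \<le> r" "r \<le> \<beta>" "F r = 0" by blast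
  have "\<mu> < r" using r F_mu by (cases "r = \<mu>") auto
  then have pr: "p < r" using pmu by simp
  have chord: "(r - \<mu>) * \<phi> p + (\<mu> - p) * \<phi> r = s * (r - p)"
    using r(3) by (simp add: F_def)
  obtain d where d: "(\<phi> has_real_derivative d) (at r within {0..\<beta>})"
    using phi_diff r mean_pos unfolding differentiable_on_def real_differentiable_def by fastforce
  define e where "e x = \<phi> x - \<phi> r - d * (x - r)" for x
  have e_nonneg: "0 \<le> e x" if "x \<in> {0..\<beta>}" for x
    using strictly_convex_above_tangent[OF phi_convex _ that d] r mean_pos by (auto simp: e_def)
  have e_p: "0 < e p"
    using strictly_convex_above_tangent_strict[OF phi_convex _ _ _ d, of p] r mean_pos p pb pr
    by (auto simp: e_def)
  have e_left: "(r - x) * e p \<le> (r - p) * e x" if "0 \<le> x" "x \<le> p" for x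
  proof -
    have "(r - x) * \<phi> p \<le> (r - p) * \<phi> x + (p - x) * \<phi> r"
      using chord_le[of x r p] that r pr by auto
    then show ?thesis by (simp add: e_def algebra_simps)
  qed
  \<comment> \<open>\<open>w\<close> is the weight at \<open>r\<close> of the law on \<open>{p, r}\<close> with mean \<open>\<mu>\<close>.\<close>
  define w where "w = (\<mu> - p) / (r - p)"
  have w: "0 < w" "w < 1" and w_eq: "w * (r - p) = \<mu> - p"
    using pmu pr \<open>\<mu> < r\<close> by (auto simp: w_def)
  define c where "c = (r - p) / e p"
  have c: "0 < c" "c * e p = r - p" using e_p pr by (auto simp: c_def)
  have c_left: "r - x \<le> c * e x" if "0 \<le> x" "x \<le> p" for x
    using e_left[OF that] e_p by (simp add: c_def field_simps)
  have e_mean: "c * (s - \<phi> r - d * (\<mu> - r)) = r - \<mu>"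
  proof -
    have "(r - p) * (s - \<phi> r - d * (\<mu> - r)) = s * (r - p) - (r - p) * (\<phi> r + d * (\<mu> - r))"
      by (simp add: algebra_simps)
    also have "\<dots> = (r - \<mu>) * e p"
      unfolding chord[symmetric] by (simp add: e_def algebra_simps)
    finally show ?thesis using e_p by (simp add: c_def)
  qed
  define E where "E t = ((r - \<mu>) * \<phi> t + (\<mu> - t) * \<phi> r) / (r - t)" for t
  \<comment> \<open>\<open>E t\<close> is the mean of \<open>\<phi>\<close> under the law on \<open>{t, r}\<close> with mean \<open>\<mu>\<close>; mixing in the point mass at \<open>\<mu>\<close>
    with weight \<open>l t\<close> brings it back to \<open>s\<close>.\<close>
  define l where "l t = (E t - s) / (E t - \<phi> \<mu>)" for t
  define k where "k t = (1 - l t) * ((\<mu> - t) / (r - t))" for t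
  have E_p: "E p = s" using chord pr by (simp add: E_def)
  have E_ge: "s \<le> E t" if t: "0 < t" "t < p" for t
  proof -
    have "(r - t) * \<phi> p \<le> (r - p) * \<phi> t + (p - t) * \<phi> r"
      using chord_le[of t r p] t r pr by auto
    then have "0 \<le> (r - \<mu>) * ((r - p) * \<phi> t + (p - t) * \<phi> r - (r - t) * \<phi> p)"
      using \<open>\<mu> < r\<close> by simp
    also have "\<dots> = (r - p) * ((r - \<mu>) * \<phi> t + (\<mu> - t) * \<phi> r)
        - (r - t) * ((r - \<mu>) * \<phi> p + (\<mu> - p) * \<phi> r)"
      by (simp add: algebra_simps)
    also have "\<dots> = (r - p) * ((r - \<mu>) * \<phi> t + (\<mu> - t) * \<phi> r - s * (r - t))"
      unfolding chord by (simp add: algebra_simps)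
    finally have "s * (r - t) \<le> (r - \<mu>) * \<phi> t + (\<mu> - t) * \<phi> r"
      using pr by (simp add: zero_le_mult_iff)
    then show ?thesis using t pr by (simp add: E_def pos_le_divide_eq)
  qed
  have l: "0 \<le> l t" "l t \<le> 1" if "0 < t" "t < p" for t
    using E_ge[OF that] phi_mean_less by (auto simp: l_def)
  have law: "\<exists>M\<in>laws. \<forall>q. measure M {q..} = (1 - l t) * ((r - \<mu>) / (r - t)) * of_bool (q \<le> t)
      + l t * of_bool (q \<le> \<mu>) + k t * of_bool (q \<le> r)"
    if t: "0 < t" "t < p" for t
  proof -
    have rt: "t < r" using t pr by simp
    have sum: "(r - \<mu>) / (r - t) + (\<mu> - t) / (r - t) = 1"
      using rt by (simp add: add_divide_distrib[symmetric])
    have mean: "(r - \<mu>) / (r - t) * t + (\<mu> - t) / (r - t) * r = \<mu>"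
    proof -
      have "(r - \<mu>) / (r - t) * t + (\<mu> - t) / (r - t) * r = ((r - \<mu>) * t + (\<mu> - t) * r) / (r - t)"
        by (simp add: add_divide_distrib)
      also have "(r - \<mu>) * t + (\<mu> - t) * r = \<mu> * (r - t)" by (simp add: algebra_simps)
      finally show ?thesis using rt by simp
    qed
    have phi_mean: "(r - \<mu>) / (r - t) * \<phi> t + (\<mu> - t) / (r - t) * \<phi> r = E t"
      by (simp add: E_def add_divide_distrib)
    show ?thesis
    proof (rule three_atom_law_in_laws)
      have "(1 - l t) * ((r - \<mu>) / (r - t)) + l t + k t
          = (1 - l t) * ((r - \<mu>) / (r - t) + (\<mu> - t) / (r - t)) + l t"
        unfolding k_def distrib_left by simp
      then show "(1 - l t) * ((r - \<mu>) / (r - t)) + l t + k t = 1"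
        unfolding sum by simp
      have "(1 - l t) * ((r - \<mu>) / (r - t)) * t + l t * \<mu> + k t * r
          = (1 - l t) * ((r - \<mu>) / (r - t) * t + (\<mu> - t) / (r - t) * r) + l t * \<mu>"
        unfolding k_def distrib_left by simp
      then show "(1 - l t) * ((r - \<mu>) / (r - t)) * t + l t * \<mu> + k t * r = \<mu>"
        unfolding mean by (simp add: algebra_simps)
      have "(1 - l t) * ((r - \<mu>) / (r - t)) * \<phi> t + l t * \<phi> \<mu> + k t * \<phi> r
          = (1 - l t) * ((r - \<mu>) / (r - t) * \<phi> t + (\<mu> - t) / (r - t) * \<phi> r) + l t * \<phi> \<mu>"
        unfolding k_def distrib_left by simp
      also have "\<dots> = E t - l t * (E t - \<phi> \<mu>)"
        unfolding phi_mean by (simp add: algebra_simps)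
      also have "\<dots> = s"
        using E_ge[OF t] phi_mean_less by (simp add: l_def)
      finally show "(1 - l t) * ((r - \<mu>) / (r - t)) * \<phi> t + l t * \<phi> \<mu> + k t * \<phi> r = s" .
      show "0 \<le> (1 - l t) * ((r - \<mu>) / (r - t))" "0 \<le> l t" "0 \<le> k t"
        unfolding k_def using l[OF t] rt r(1) pmu t by (auto intro!: mult_nonneg_nonneg)
    qed (use t p pb r mean_pos mean_less in auto)
  qed
  have "(E \<longlongrightarrow> E p) (at_left p)"
    unfolding E_def by (intro tendsto_intros phi_tendsto_left) (use p pb pr in auto)
  then have "(l \<longlongrightarrow> (s - s) / (s - \<phi> \<mu>)) (at_left p)"
    unfolding l_def E_p by (intro tendsto_intros) (use phi_mean_less in auto)
  then have l_lim: "(l \<longlongrightarrow> 0) (at_left p)" by simp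
  have "(k \<longlongrightarrow> (1 - 0) * w) (at_left p)"
    unfolding k_def w_def by (intro tendsto_intros l_lim) (use pr in auto)
  then have k_lim: "(k \<longlongrightarrow> w) (at_left p)" by simp
  show ?thesis
  proof (rule Inf_CR_eq_of_extremal_family[where w = w and V = 1 and r = r
        and u = "\<lambda>t. l t + k t" and v = "\<lambda>t. 1" and k = k])
    show "0 < p" "0 < r" "0 \<le> w" "(0::real) < 1" using p pr w by auto
    \<comment> \<open>The minorant \<open>1 - e(x) / e(p)\<close> of \<open>1(x \<ge> p)\<close> is 1 at its tangent point \<open>r\<close> and 0 at \<open>p\<close>.\<close>
    show "w \<le> measure M {p..}" if M: "M \<in> laws" for M
    proof -
      define c' where "c' = 1 / e p"
      have c': "c' * e p = 1" "0 < c'" "c' * (r - p) = c" using e_p by (auto simp: c'_def c_def)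
      have "1 + c' * \<phi> r - c' * d * r + c' * d * \<mu> + - c' * s \<le> measure M {p..}"
      proof (rule tail_ge_minorant[OF M])
        fix x assume x: "x \<in> {0..\<beta>}"
        have "1 - c' * e x \<le> indicator {p..} x"
        proof (cases "x < p")
          case True
          have "(r - p) * e p \<le> (r - x) * e p" using True e_p by simp
          also have "\<dots> \<le> (r - p) * e x" using e_left True x by auto
          finally have "e p \<le> e x" using pr by simp
          then have "c' * e p \<le> c' * e x" using c'(2) by (intro mult_left_mono) auto
          then show ?thesis using True c' by simp
        next
          case False
          then show ?thesis using e_nonneg[OF x] c' by simp
        qed
        then show "1 + c' * \<phi> r - c' * d * r + c' * d * x + - c' * \<phi> x \<le> indicator {p..} x"
          by (simp add: e_def algebra_simps)
      qed
      moreover have "1 + c' * \<phi> r - c' * d * r + c' * d * \<mu> + - c' * s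
          = 1 - c' * (s - \<phi> r - d * (\<mu> - r))"
        by (simp add: algebra_simps)
      moreover have "\<dots> = w"
      proof -
        have "(r - p) * (1 - c' * (s - \<phi> r - d * (\<mu> - r)))
            = (r - p) - (c' * (r - p)) * (s - \<phi> r - d * (\<mu> - r))"
          by (simp add: algebra_simps)
        also have "\<dots> = (r - p) * w" unfolding c'(3) e_mean using w_eq by (simp add: algebra_simps)
        finally show ?thesis using pr by simp
      qed
      ultimately show ?thesis by simp
    qed
    show "t * measure M {t..} \<le> p * 1" if "M \<in> laws" "0 < t" "t \<le> p" for M t
      using mult_mono[of t p "measure M {t..}" 1] that law_tail_le_1 p by simp
    show "\<exists>M\<in>laws. 1 \<le> measure M {p..}"
    proof -
      have "\<exists>M\<in>laws. \<forall>q. measure M {q..} = (1 - w) * of_bool (q \<le> p)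
          + 0 * of_bool (q \<le> p) + w * of_bool (q \<le> r)"
      proof (rule three_atom_law_in_laws)
        show "(1 - w) * p + 0 * p + w * r = \<mu>" using w_eq by (simp add: algebra_simps)
        have "(r - p) * ((1 - w) * \<phi> p + 0 * \<phi> p + w * \<phi> r)
            = ((r - p) - w * (r - p)) * \<phi> p + w * (r - p) * \<phi> r"
          by (simp add: algebra_simps)
        also have "\<dots> = s * (r - p)" unfolding w_eq using chord by simp
        finally show "(1 - w) * \<phi> p + 0 * \<phi> p + w * \<phi> r = s" using pr by simp
      qed (use w p pb r mean_pos in auto)
      then obtain M where M: "M \<in> laws" "\<And>q. measure M {q..} = (1 - w) * of_bool (q \<le> p)
          + 0 * of_bool (q \<le> p) + w * of_bool (q \<le> r)" by blast
      have "1 \<le> measure M {p..}" unfolding M(2) using pr by simp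
      then show ?thesis using M(1) by blast
    qed
    \<comment> \<open>The majorant \<open>x - r + c e(x)\<close> of \<open>(x - r) 1(x \<ge> p)\<close> vanishes at both atoms.\<close>
    show "partial_mean p M \<le> r * measure M {p..}" if M: "M \<in> laws" for M
    proof -
      have "partial_mean p M - r * measure M {p..}
          \<le> (c * d * r - r - c * \<phi> r) + (1 - c * d) * \<mu> + c * s"
      proof (rule partial_mean_minus_tail_le[OF M])
        fix x assume x: "x \<in> {0..\<beta>}"
        have "(x - r) * indicator {p..} x \<le> x - r + c * e x"
        proof (cases "x < p")
          case True
          then show ?thesis using c_left[of x] x by simp
        next
          case False
          then show ?thesis using e_nonneg[OF x] c by simp
        qed
        then show "(x - r) * indicator {p..} x \<le> (c * d * r - r - c * \<phi> r) + (1 - c * d) * x + c * \<phi> x"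
          by (simp add: e_def algebra_simps)
      qed
      also have "\<dots> = \<mu> - r + c * (s - \<phi> r - d * (\<mu> - r))"
        by (simp add: algebra_simps)
      finally show ?thesis unfolding e_mean by simp
    qed
    have "\<forall>\<^sub>F t in at_left p. t \<in> {0<..<p}"
      using p(1) by (rule eventually_at_left_real)
    then show "\<forall>\<^sub>F t in at_left p. \<exists>M\<in>laws.
        measure M {p..} = l t + k t \<and> 1 \<le> measure M {t..} \<and> k t \<le> measure M {r..}"
    proof eventually_elim
      case (elim t)
      then obtain M where M: "M \<in> laws" "\<And>q. measure M {q..}
          = (1 - l t) * ((r - \<mu>) / (r - t)) * of_bool (q \<le> t) + l t * of_bool (q \<le> \<mu>) + k t * of_bool (q \<le> r)"
        using law[of t] by force
      have "1 \<le> measure M {t..}"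
      proof -
        have "(r - \<mu>) / (r - t) + (\<mu> - t) / (r - t) = 1"
          using elim pr by (simp add: add_divide_distrib[symmetric])
        then have "(1 - l t) * ((r - \<mu>) / (r - t)) + l t + k t = 1"
          unfolding k_def by (metis add.assoc add.commute diff_add_cancel distrib_left mult.right_neutral)
        then show ?thesis unfolding M(2) using elim pmu pr by simp
      qed
      moreover have "measure M {p..} = l t + k t" "k t \<le> measure M {r..}"
        unfolding M(2) using elim pmu pr \<open>\<mu> < r\<close> by auto
      ultimately show ?case using M(1) by blast
    qed
    have "((\<lambda>t. l t + k t) \<longlongrightarrow> 0 + w) (at_left p)"
      by (intro tendsto_intros l_lim k_lim)
    then show "((\<lambda>t. l t + k t) \<longlongrightarrow> w) (at_left p)" by simp
  qed (auto intro: k_lim)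
qed

end

section \<open>The formula for the worst-case competitive ratio\<close>

theorem theorem3p1:
  fixes \<mu> \<beta> s \<tau>\<^sub>2 p :: real and \<phi> :: "real \<Rightarrow> real"
  assumes "0 < \<mu>" and "\<mu> < \<beta>"
    and "\<And>x. x \<in> {0..\<beta>} \<Longrightarrow> 0 \<le> \<phi> x"
    and "strictly_convex_on {0..\<beta>} \<phi>"
    and "\<phi> differentiable_on {0..\<beta>}"
    and "\<phi> \<mu> < s"
    and "0 < \<tau>\<^sub>2" and "\<tau>\<^sub>2 < \<beta>"
    and "(\<phi> \<tau>\<^sub>2 - \<phi> 0) / \<tau>\<^sub>2 = (s - \<phi> 0) / \<mu>"
    and "0 < p" and "p \<le> \<beta>"
  shows "(INF M\<in>ambiguity_set \<mu> s \<beta> \<phi>. CR p M) =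
    min ((INF M\<in>ambiguity_set \<mu> s \<beta> \<phi>. measure M {p..}) /
         (SUP M\<in>ambiguity_set \<mu> s \<beta> \<phi>. measure M {p..}))
        (p / (SUP M\<in>{M \<in> ambiguity_set \<mu> s \<beta> \<phi>. measure M {p..} > 0}. cond_mean_ge p M))"
proof -
  interpret feasible_moment_problem \<mu> \<beta> s \<phi> \<tau>\<^sub>2
    using assms by unfold_locales auto
  consider "\<tau>\<^sub>2 < p"
    | "p \<le> \<tau>\<^sub>2" "(\<beta> - \<mu>) * \<phi> p + (\<mu> - p) * \<phi> \<beta> < s * (\<beta> - p)"
    | "p \<le> \<tau>\<^sub>2" "s * (\<beta> - p) \<le> (\<beta> - \<mu>) * \<phi> p + (\<mu> - p) * \<phi> \<beta>"
    by linarith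
  then show ?thesis
    using Inf_CR_high_price Inf_CR_atoms_0_p_top Inf_CR_atoms_p_r assms(10,11) by cases blast+
qed

end
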